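(* Let $\Delta>0$, $\varepsilon\ge0$, $\varrho>0$, and suppose a DC power network with limit vector $\xi\in\Omega$ and cost vector $f\in\Omega_f(\xi)$ is $(\Delta,\varepsilon)$-monotone. Let $\mathcal{R}_1,\dots,\mathcal{R}_r$ be a partition of the set of buses $\mathcal{V}$, and let $\mathcal{M}=[\mathcal{M}^g_1,\dots,\mathcal{M}^g_r,\mathcal{M}^l_1,\dots,\mathcal{M}^l_r]^{\mathsf T}$ be the aggregation mechanism, $\mathcal{M}^g_i=\sum_{j\in\mathcal{R}_i\cap\mathcal{V}_G}s^g_j+Y^g_i$, $\mathcal{M}^l_i=\sum_{j:\,j+N_G\in\mathcal{R}_i\cap\mathcal{V}_L}s^l_j+Y^l_i$, with $s^g=\mathcal{OPF}(s^l)$, where all $Y^g_i,Y^l_i$ ($1\le i\le r$) are drawn i.i.d. from the Laplace distribution $\mathscr{L}(2(\Delta+\varepsilon)/\varrho)$. Then $\mathcal{M}$ preserves $(\Delta,\varrho)$-differential privacy.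
   Context: Network. $\mathcal{G}(\mathcal{V},\mathcal{E})$ is a connected finite undirected graph without self-loops, with $\mathcal{V}=\mathcal{V}_G\cup\mathcal{V}_L$, $\mathcal{V}_G=\{1,\dots,N_G\}$ (generators), $\mathcal{V}_L=\{N_G+1,\dots,N_G+N_L\}$ (loads; disjoint from the generators), $N_G,N_L\ge1$, $N=N_G+N_L$, and edges (branches) labelled $1,\dots,E$. $C\in\mathbb{R}^{N\times E}$ is the signed incidence matrix (for a fixed orientation of the edges), $B=\mathrm{diag}(b_1,\dots,b_E)$ with all $b_e>0$. Vector inequalities are componentwise (strict: strict in every component). $\|x\|_0$ is the number of nonzero entries of $x$. DC OPF. The limit vector is $\xi=(\overline{s}^g,\underline{s}^g,\overline{p},\underline{p})\in\mathbb{R}^{2N_G+2E}$, always with $\overline{s}^g>\underline{s}^g$ and $\overline{p}>\underline{p}$. Given loads $s^l\in\mathbb{R}^{N_L}$ ($s^l_i$ is the load at bus $N_G+i$) and cost vector $f\in\mathbb{R}^{N_G}$, the problem is to minimize $f^{\mathsf T}s^g$ over $s^g\in\mathbb{R}^{N_G}$, $\theta\in\mathbb{R}^N$ subject to (i) $\theta_1=0$; (ii) $CBC^{\mathsf T}\theta=\begin{bmatrix}s^g\\-s^l\end{bmatrix}$; (iii) $\underline{s}^g\le s^g\le\overline{s}^g$; (iv) $\underline{p}\le BC^{\mathsf T}\theta\le\overline{p}$. Sets. $\Omega$ is the set of limit vectors $\xi$ with $\underline{s}^g\ge0$ for which (i)-(iv) is feasible for some $s^l>0$. For $\xi\in\Omega$,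 $\Omega_s(\xi)$ is the set of $s^l>0$ for which (i)-(iv) is feasible. KKT conditions. With $M=\begin{bmatrix}CBC^{\mathsf T}\\ 1\;0\;\cdots\;0\end{bmatrix}\in\mathbb{R}^{(N+1)\times N}$ and multipliers $\tau\in\mathbb{R}^{N+1}$, $\lambda_+,\lambda_-\in\mathbb{R}^{N_G}$, $\mu_+,\mu_-\in\mathbb{R}^E$, they are: (i)-(iv); $0=M^{\mathsf T}\tau+CB(\mu_+-\mu_-)$; $-f=-(\tau_1,\dots,\tau_{N_G})^{\mathsf T}+\lambda_+-\lambda_-$; $\mu_\pm,\lambda_\pm\ge0$; $\mu_+^{\mathsf T}(BC^{\mathsf T}\theta-\overline{p})=\mu_-^{\mathsf T}(\underline{p}-BC^{\mathsf T}\theta)=0$; $\lambda_+^{\mathsf T}(s^g-\overline{s}^g)=\lambda_-^{\mathsf T}(\underline{s}^g-s^g)=0$. $\Omega_f(\xi)$ is the set of $f\in\mathbb{R}^{N_G}$ such that for all $s^l\in\Omega_s(\xi)$ the DC OPF has a unique solution and all multipliers satisfying the KKT conditions satisfy $\|\mu_+\|_0+\|\mu_-\|_0+\|\lambda_+\|_0+\|\lambda_-\|_0\ge N_G-1$. For $f\in\Omega_f(\xi)$, $\mathcal{OPF}:\Omega_s(\xi)\to\mathbb{R}^{N_G}$ maps $s^l$ to the unique optimal $s^g$. $(\delta,\varepsilon)$-monotone ($\delta>0$, $\varepsilon\ge0$): for all $\alpha,\beta\in\Omega_s(\xi)$ with $\beta+\delta\mathbf{1}\ge\alpha\ge\beta$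 and $\|\alpha-\beta\|_0=1$, one has $\sum_{i=1}^{N_G}[\mathcal{OPF}_i(\alpha)-\mathcal{OPF}_i(\beta)]^-\ge-\varepsilon$, where $[k]^-=\min\{0,k\}$. Laplace distribution. $\mathscr{L}(b)$, $b>0$, has density $x\mapsto\frac1{2b}\exp(-|x|/b)$ on $\mathbb{R}$. $(\Delta,\varrho)$-differential privacy. A randomized function $\mathcal{M}$ of $s^l\in\Omega_s(\xi)$ with values in $\mathbb{R}^m$ preserves $(\Delta,\varrho)$-differential privacy if for all $s',s''\in\Omega_s(\xi)$ with $\|s'-s''\|_0\le1$ and $\|s'-s''\|_1\le\Delta$ and all Borel $\mathcal{W}\subseteq\mathbb{R}^m$, $\mathbb{P}\{\mathcal{M}(s')\in\mathcal{W}\}\le e^{\varrho}\,\mathbb{P}\{\mathcal{M}(s'')\in\mathcal{W}\}$. *)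

theory Defs
  imports "HOL-Probability.Probability"
begin

text \<open>
  Buses are the elements of the sum type \<open>'g + 'l\<close> (\<open>Inl\<close>: generators, \<open>Inr\<close>: loads), branches the
  elements of \<open>'e\<close>; so \<open>CARD('g)\<close>, \<open>CARD('l)\<close>, \<open>CARD('e)\<close> are the numbers of generators, loads and
  branches. \<open>ref_gen\<close> is the generator labelled 1, whose phase angle is fixed to 0. The pair
  \<open>src\<close>, \<open>tgt\<close> is the fixed orientation of the branches.
\<close>

record ('g, 'l, 'e) dc_network =
  src :: "'e \<Rightarrow> 'g + 'l"
  tgt :: "'e \<Rightarrow> 'g + 'l"
  suscept :: "real ^ 'e"
  ref_gen :: 'g

definition adjacent :: "('g, 'l, 'e::finite) dc_network \<Rightarrow> (('g + 'l) \<times> ('g + 'l)) set" where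
  "adjacent net = {(u, v). \<exists>e. {u, v} = {src net e, tgt net e}}"

text \<open>Parallel branches are not excluded; the branch type is nonempty, as it has to be in a
  connected graph with at least two buses.\<close>

definition valid_network :: "('g, 'l, 'e::finite) dc_network \<Rightarrow> bool" where
  "valid_network net \<longleftrightarrow>
     (\<forall>e. src net e \<noteq> tgt net e) \<and>
     (\<forall>u v. (u, v) \<in> (adjacent net)\<^sup>*) \<and>
     (\<forall>e. suscept net $ e > 0)"

definition incidence :: "('g::finite, 'l::finite, 'e::finite) dc_network \<Rightarrow> real ^ 'e ^ ('g + 'l)" where
  "incidence net = (\<chi> v e. if v = src net e then 1 else if v = tgt net e then - 1 else 0)"

definition susceptance :: "('g, 'l, 'e::finite) dc_network \<Rightarrow> real ^ 'e ^ 'e" where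
  "susceptance net = (\<chi> e e'. if e = e' then suscept net $ e else 0)"

definition laplacian :: "('g::finite, 'l::finite, 'e::finite) dc_network \<Rightarrow> real ^ ('g + 'l) ^ ('g + 'l)" where
  "laplacian net = incidence net ** susceptance net ** transpose (incidence net)"

definition branch_flow ::
  "('g::finite, 'l::finite, 'e::finite) dc_network \<Rightarrow> real ^ ('g + 'l) \<Rightarrow> real ^ 'e" where
  "branch_flow net \<theta> = (susceptance net ** transpose (incidence net)) *v \<theta>"

text \<open>The library's \<open>\<le>\<close> on \<open>real ^ 'n\<close> is componentwise, but its \<open><\<close> is not strict in every
  component.\<close>

definition all_less :: "real ^ 'n::finite \<Rightarrow> real ^ 'n \<Rightarrow> bool" where
  "all_less x y \<longleftrightarrow> (\<forall>i. x $ i < y $ i)"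

definition norm0 :: "real ^ 'n::finite \<Rightarrow> nat" where
  "norm0 x = card {i. x $ i \<noteq> 0}"

definition norm1 :: "real ^ 'n::finite \<Rightarrow> real" where
  "norm1 x = (\<Sum>i\<in>UNIV. \<bar>x $ i\<bar>)"

record ('g, 'e) limits =
  s_max :: "real ^ 'g"
  s_min :: "real ^ 'g"
  p_max :: "real ^ 'e"
  p_min :: "real ^ 'e"

definition injection :: "real ^ 'g::finite \<Rightarrow> real ^ 'l::finite \<Rightarrow> real ^ ('g + 'l)" where
  "injection sg sl = (\<chi> v. case v of Inl i \<Rightarrow> sg $ i | Inr j \<Rightarrow> - sl $ j)"

definition feasible ::
  "('g::finite, 'l::finite, 'e::finite) dc_network \<Rightarrow> ('g, 'e) limits \<Rightarrow> real ^ 'l \<Rightarrow>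
   real ^ 'g \<Rightarrow> real ^ ('g + 'l) \<Rightarrow> bool" where
  "feasible net \<xi> sl sg \<theta> \<longleftrightarrow>
     \<theta> $ Inl (ref_gen net) = 0 \<and>
     laplacian net *v \<theta> = injection sg sl \<and>
     s_min \<xi> \<le> sg \<and> sg \<le> s_max \<xi> \<and>
     p_min \<xi> \<le> branch_flow net \<theta> \<and> branch_flow net \<theta> \<le> p_max \<xi>"

definition opf_solution ::
  "('g::finite, 'l::finite, 'e::finite) dc_network \<Rightarrow> ('g, 'e) limits \<Rightarrow> real ^ 'g \<Rightarrow> real ^ 'l \<Rightarrow>
   (real ^ 'g) \<times> (real ^ ('g + 'l)) \<Rightarrow> bool" where
  "opf_solution net \<xi> f sl = (\<lambda>(sg, \<theta>).
     feasible net \<xi> sl sg \<theta> \<and>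
     (\<forall>sg' \<theta>'. feasible net \<xi> sl sg' \<theta>' \<longrightarrow> f \<bullet> sg \<le> f \<bullet> sg'))"

definition Omega :: "('g::finite, 'l::finite, 'e::finite) dc_network \<Rightarrow> ('g, 'e) limits set" where
  "Omega net = {\<xi>.
     all_less (s_min \<xi>) (s_max \<xi>) \<and> all_less (p_min \<xi>) (p_max \<xi>) \<and> 0 \<le> s_min \<xi> \<and>
     (\<exists>sl. all_less 0 sl \<and> (\<exists>sg \<theta>. feasible net \<xi> sl sg \<theta>))}"

definition Omega_s ::
  "('g::finite, 'l::finite, 'e::finite) dc_network \<Rightarrow> ('g, 'e) limits \<Rightarrow> (real ^ 'l) set" where
  "Omega_s net \<xi> = {sl. all_less 0 sl \<and> (\<exists>sg \<theta>. feasible net \<xi> sl sg \<theta>)}"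

text \<open>The Laplacian with the row \<open>(1, 0, \<dots>, 0)\<close> appended: row \<open>Some v\<close> is the row of bus \<open>v\<close>,
  \<open>None\<close> the additional last row.\<close>

definition kkt_matrix ::
  "('g::finite, 'l::finite, 'e::finite) dc_network \<Rightarrow> real ^ ('g + 'l) ^ (('g + 'l) option)" where
  "kkt_matrix net = (\<chi> k. case k of Some v \<Rightarrow> laplacian net $ v | None \<Rightarrow> axis (Inl (ref_gen net)) 1)"

definition KKT ::
  "('g::finite, 'l::finite, 'e::finite) dc_network \<Rightarrow> ('g, 'e) limits \<Rightarrow> real ^ 'g \<Rightarrow> real ^ 'l \<Rightarrow>
   real ^ 'g \<Rightarrow> real ^ ('g + 'l) \<Rightarrow> real ^ (('g + 'l) option) \<Rightarrow>
   real ^ 'g \<Rightarrow> real ^ 'g \<Rightarrow> real ^ 'e \<Rightarrow> real ^ 'e \<Rightarrow> bool" where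
  "KKT net \<xi> f sl sg \<theta> \<tau> lam_p lam_m mu_p mu_m \<longleftrightarrow>
     feasible net \<xi> sl sg \<theta> \<and>
     0 = transpose (kkt_matrix net) *v \<tau> + (incidence net ** susceptance net) *v (mu_p - mu_m) \<and>
     - f = - (\<chi> i. \<tau> $ Some (Inl i)) + lam_p - lam_m \<and>
     0 \<le> mu_p \<and> 0 \<le> mu_m \<and> 0 \<le> lam_p \<and> 0 \<le> lam_m \<and>
     mu_p \<bullet> (branch_flow net \<theta> - p_max \<xi>) = 0 \<and>
     mu_m \<bullet> (p_min \<xi> - branch_flow net \<theta>) = 0 \<and>
     lam_p \<bullet> (sg - s_max \<xi>) = 0 \<and>
     lam_m \<bullet> (s_min \<xi> - sg) = 0"

definition Omega_f ::
  "('g::finite, 'l::finite, 'e::finite) dc_network \<Rightarrow> ('g, 'e) limits \<Rightarrow> (real ^ 'g) set" where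
  "Omega_f net \<xi> = {f. \<forall>sl \<in> Omega_s net \<xi>.
     (\<exists>!z. opf_solution net \<xi> f sl z) \<and>
     (\<forall>sg \<theta> \<tau> lam_p lam_m mu_p mu_m. KKT net \<xi> f sl sg \<theta> \<tau> lam_p lam_m mu_p mu_m \<longrightarrow>
        norm0 mu_p + norm0 mu_m + norm0 lam_p + norm0 lam_m \<ge> CARD('g) - 1)}"

text \<open>Meaningful for \<open>f \<in> Omega_f net \<xi>\<close> and \<open>sl \<in> Omega_s net \<xi>\<close> only.\<close>

definition OPF ::
  "('g::finite, 'l::finite, 'e::finite) dc_network \<Rightarrow> ('g, 'e) limits \<Rightarrow> real ^ 'g \<Rightarrow> real ^ 'l \<Rightarrow> real ^ 'g" where
  "OPF net \<xi> f sl = fst (THE z. opf_solution net \<xi> f sl z)"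

definition monotone_network ::
  "real \<Rightarrow> real \<Rightarrow> ('g::finite, 'l::finite, 'e::finite) dc_network \<Rightarrow> ('g, 'e) limits \<Rightarrow> real ^ 'g \<Rightarrow> bool" where
  "monotone_network \<delta> \<epsilon> net \<xi> f \<longleftrightarrow>
     (\<forall>\<alpha> \<in> Omega_s net \<xi>. \<forall>\<beta> \<in> Omega_s net \<xi>.
        \<alpha> \<le> \<beta> + vec \<delta> \<longrightarrow> \<beta> \<le> \<alpha> \<longrightarrow> norm0 (\<alpha> - \<beta>) = 1 \<longrightarrow>
        (\<Sum>i\<in>UNIV. min 0 (OPF net \<xi> f \<alpha> $ i - OPF net \<xi> f \<beta> $ i)) \<ge> - \<epsilon>)"

definition laplace_density :: "real \<Rightarrow> real \<Rightarrow> real" where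
  "laplace_density b x = 1 / (2 * b) * exp (- \<bar>x\<bar> / b)"

definition iid_laplace :: "'w measure \<Rightarrow> real \<Rightarrow> ('k \<Rightarrow> 'w \<Rightarrow> real) \<Rightarrow> bool" where
  "iid_laplace P b Y \<longleftrightarrow>
     prob_space.indep_vars P (\<lambda>_. borel) Y UNIV \<and>
     (\<forall>k. distributed P lborel (Y k) (\<lambda>x. ennreal (laplace_density b x)))"

text \<open>A randomized function on \<open>S\<close> is a family of random vectors on a probability space \<open>P\<close>.
  Measurability is part of the notion, since \<open>measure\<close> is 0 on nonmeasurable sets.\<close>

definition differentially_private ::
  "'w measure \<Rightarrow> (real ^ 'l::finite) set \<Rightarrow> real \<Rightarrow> real \<Rightarrow> (real ^ 'l \<Rightarrow> 'w \<Rightarrow> real ^ 'm::finite) \<Rightarrow> bool" where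
  "differentially_private P S \<Delta> \<rho> F \<longleftrightarrow>
     (\<forall>s \<in> S. F s \<in> borel_measurable P) \<and>
     (\<forall>s' \<in> S. \<forall>s'' \<in> S. norm0 (s' - s'') \<le> 1 \<longrightarrow> norm1 (s' - s'') \<le> \<Delta> \<longrightarrow>
        (\<forall>W \<in> sets borel.
           measure P {\<omega> \<in> space P. F s' \<omega> \<in> W} \<le> exp \<rho> * measure P {\<omega> \<in> space P. F s'' \<omega> \<in> W}))"

text \<open>Component \<open>Inl i\<close> is the noisy total generation of region \<open>R i\<close>, component \<open>Inr i\<close> its noisy
  total load.\<close>

definition aggregation_mechanism ::
  "('g::finite, 'l::finite, 'e::finite) dc_network \<Rightarrow> ('g, 'e) limits \<Rightarrow> real ^ 'g \<Rightarrow>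
   ('r::finite \<Rightarrow> ('g + 'l) set) \<Rightarrow> ('r \<Rightarrow> 'w \<Rightarrow> real) \<Rightarrow> ('r \<Rightarrow> 'w \<Rightarrow> real) \<Rightarrow>
   real ^ 'l \<Rightarrow> 'w \<Rightarrow> real ^ ('r + 'r)" where
  "aggregation_mechanism net \<xi> f R Yg Yl sl \<omega> = (\<chi> k. case k of
     Inl i \<Rightarrow> (\<Sum>j | Inl j \<in> R i. OPF net \<xi> f sl $ j) + Yg i \<omega>
   | Inr i \<Rightarrow> (\<Sum>j | Inr j \<in> R i. sl $ j) + Yl i \<omega>)"

end

theory Submission imports Defs begin

text \<open>Lossless power balance says that total generation equals total load. If the load at a single bus
  is raised by \<open>d \<le> \<Delta>\<close>, then total generation also rises by \<open>d\<close>; monotonicity bounds the total decrease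
  of the individual generators by \<open>\<epsilon>\<close>, so that the total increase is at most \<open>d + \<epsilon>\<close>. Hence the
  generation profile moves by at most \<open>\<Delta> + 2 * \<epsilon>\<close> and the load profile by at most \<open>\<Delta>\<close> in \<open>L\<^sup>1\<close>-norm.
  Summing over disjoint regions does not increase the distance, so the noise level
  \<open>2 * (\<Delta> + \<epsilon>) / \<rho>\<close> is the one required by the Laplace mechanism.\<close>

section \<open>The Laplace mechanism\<close>

definition laplace_measure :: "real \<Rightarrow> real measure" where
  "laplace_measure b = density lborel (\<lambda>x. ennreal (laplace_density b x))"

lemma laplace_density_measurable [measurable]: "laplace_density b \<in> borel_measurable borel"
  unfolding laplace_density_def by measurable

lemma sets_laplace_measure [measurable_cong, simp]: "sets (laplace_measure b) = sets borel"
  by (simp add: laplace_measure_def)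

text \<open>The density takes finite values, which suffices over a sigma-finite base measure. This
  licenses the iterated integrals over product measures below.\<close>

lemma sigma_finite_laplace_measure: "sigma_finite_measure (laplace_measure b)"
  unfolding laplace_measure_def by (subst sigma_finite_measure.sigma_finite_iff_density_finite[OF sigma_finite_lborel]) auto

text \<open>Triangle inequality \<open>\<bar>x - d\<bar> \<le> \<bar>x - c\<bar> + \<bar>c -
  d\<bar>\<close> in the exponent. This is the pointwise source of the privacy factor.\<close>

lemma laplace_density_shift:
  assumes "b > 0"
  shows "laplace_density b (x - c) \<le> exp (\<bar>c - d\<bar> / b) * laplace_density b (x - d)"
proof -
  have "- \<bar>x - c\<bar> / b \<le> \<bar>c - d\<bar> / b + - \<bar>x - d\<bar> / b"
    using assms by (simp add: field_simps)
  then have "exp (- \<bar>x - c\<bar> / b) \<le> exp (\<bar>c - d\<bar> / b) * exp (- \<bar>x - d\<bar> / b)"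
    by (simp flip: exp_add)
  from mult_left_mono[OF this, of "1 / (2 * b)"] assms show ?thesis
    by (simp add: laplace_density_def mult_ac)
qed

text \<open>Substituting \<open>y = x - c\<close> moves the shift from the integrand into the
  density, so that different shifts share the same integrand.\<close>

lemma nn_integral_laplace_translate:
  assumes [measurable]: "h \<in> borel_measurable borel"
  shows "(\<integral>\<^sup>+y. h (c + y) \<partial>laplace_measure b) = (\<integral>\<^sup>+x. ennreal (laplace_density b (x - c)) * h x \<partial>lborel)"
proof -
  have "(\<integral>\<^sup>+y. h (c + y) \<partial>laplace_measure b) = (\<integral>\<^sup>+y. ennreal (laplace_density b y) * h (c + y) \<partial>lborel)"
    unfolding laplace_measure_def by (subst nn_integral_density) auto
  also have "\<dots> = (\<integral>\<^sup>+x. ennreal (laplace_density b (x - c)) * h x \<partial>lborel)"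
    by (subst nn_integral_real_affine[where c=1 and t="- c"]) auto
  finally show ?thesis .
qed

lemma nn_integral_laplace_shift:
  assumes "b > 0" and [measurable]: "h \<in> borel_measurable borel"
  shows "(\<integral>\<^sup>+y. h (c + y) \<partial>laplace_measure b)
    \<le> ennreal (exp (\<bar>c - d\<bar> / b)) * (\<integral>\<^sup>+y. h (d + y) \<partial>laplace_measure b)"
proof -
  have "(\<integral>\<^sup>+x. ennreal (laplace_density b (x - c)) * h x \<partial>lborel)
    \<le> (\<integral>\<^sup>+x. ennreal (exp (\<bar>c - d\<bar> / b)) * (ennreal (laplace_density b (x - d)) * h x) \<partial>lborel)"
    using laplace_density_shift[OF assms(1)]
    by (intro nn_integral_mono)
       (auto simp flip: mult.assoc ennreal_mult' intro!: mult_right_mono ennreal_leI)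
  then show ?thesis
    by (simp add: nn_integral_laplace_translate nn_integral_cmult)
qed

text \<open>One coordinate is recentred at a time, and the factors multiply to the exponential of
  the \<open>L1\<close> distance. Arbitrary nonnegative \<open>h\<close> instead of indicators of
  events are needed for the induction: integrating out one coordinate of an indicator no longer
  gives an indicator.\<close>

lemma nn_integral_PiM_laplace_shift:
  fixes c d :: "'k \<Rightarrow> real"
  assumes "finite I" and b: "b > 0" and "h \<in> borel_measurable (PiM I (\<lambda>_. borel))"
  shows "(\<integral>\<^sup>+x. h (\<lambda>k\<in>I. c k + x k) \<partial>PiM I (\<lambda>_. laplace_measure b))
    \<le> ennreal (exp ((\<Sum>k\<in>I. \<bar>c k - d k\<bar>) / b))
       * (\<integral>\<^sup>+x. h (\<lambda>k\<in>I. d k + x k) \<partial>PiM I (\<lambda>_. laplace_measure b))"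
  using assms(1,3)
proof (induction I arbitrary: h rule: finite_induct)
  case empty
  then show ?case by simp
next
  case (insert i I)
  let ?L = "laplace_measure b"
  interpret L: sigma_finite_measure ?L by (rule sigma_finite_laplace_measure)
  interpret product_sigma_finite "\<lambda>_::'k. ?L" by standard
  note [measurable] = insert.prems
  let ?s = "\<lambda>c x. \<lambda>k\<in>I. c k + x k"
  \<comment> \<open>Tonelli: the new coordinate \<open>i\<close> becomes the inner integral, the old
    ones the outer.\<close>
  have split: "(\<integral>\<^sup>+x. h (\<lambda>k\<in>insert i I. c k + x k) \<partial>PiM (insert i I) (\<lambda>_. ?L))
      = (\<integral>\<^sup>+x. \<integral>\<^sup>+y. h ((?s c x)(i := c i + y)) \<partial>?L \<partial>PiM I (\<lambda>_. ?L))" for c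
  proof -
    have "(\<lambda>k\<in>insert i I. c k + (x(i := y)) k) = (?s c x)(i := c i + y)" for x y
      using insert.hyps by (auto simp: fun_eq_iff)
    then show ?thesis
      using insert.hyps by (subst product_nn_integral_insert) auto
  qed
  let ?e = "\<lambda>k. \<bar>c k - d k\<bar> / b"
  \<comment> \<open>Coordinate \<open>i\<close> is already recentred at \<open>d i\<close> here; the
    induction hypothesis is applied to this function of the remaining coordinates.\<close>
  let ?g = "\<lambda>x. \<integral>\<^sup>+y. h (x(i := d i + y)) \<partial>?L"
  have upd: "(\<lambda>p. (fst p)(i := d i + snd p))
      \<in> PiM I (\<lambda>_. borel) \<Otimes>\<^sub>M ?L \<rightarrow>\<^sub>M PiM (insert i I) (\<lambda>_. borel)"
    by (rule measurable_fun_upd[where J=I]) auto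
  have g: "?g \<in> borel_measurable (PiM I (\<lambda>_. borel))"
    using measurable_compose[OF upd insert.prems]
    by (intro L.borel_measurable_nn_integral) (simp add: case_prod_beta)
  have s_meas: "?s c \<in> PiM I (\<lambda>_. ?L) \<rightarrow>\<^sub>M PiM I (\<lambda>_. borel)" for c
    by (intro measurable_restrict) (auto intro!: borel_measurable_add)
  have "(\<integral>\<^sup>+y. h ((?s c x)(i := c i + y)) \<partial>?L) \<le> ennreal (exp (?e i)) * ?g (?s c x)" for x
  proof -
    have "(\<lambda>y. (?s c x)(i := y)) \<in> borel \<rightarrow>\<^sub>M PiM (insert i I) (\<lambda>_. borel)"
      by (rule measurable_component_update) (use insert.hyps in \<open>auto simp: space_PiM\<close>)
    from measurable_compose[OF this insert.prems] nn_integral_laplace_shift[OF b]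
    show ?thesis by blast
  qed
  then have "(\<integral>\<^sup>+x. \<integral>\<^sup>+y. h ((?s c x)(i := c i + y)) \<partial>?L \<partial>PiM I (\<lambda>_. ?L))
      \<le> (\<integral>\<^sup>+x. ennreal (exp (?e i)) * ?g (?s c x) \<partial>PiM I (\<lambda>_. ?L))"
    by (intro nn_integral_mono)
  also have "\<dots> = ennreal (exp (?e i)) * (\<integral>\<^sup>+x. ?g (?s c x) \<partial>PiM I (\<lambda>_. ?L))"
    using measurable_compose[OF s_meas g] by (intro nn_integral_cmult)
  also have "\<dots> \<le> ennreal (exp (?e i)) *
      (ennreal (exp ((\<Sum>k\<in>I. \<bar>c k - d k\<bar>) / b)) * (\<integral>\<^sup>+x. ?g (?s d x) \<partial>PiM I (\<lambda>_. ?L)))"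
    by (intro mult_left_mono insert.IH g) auto
  also have "\<dots> = ennreal (exp ((\<Sum>k\<in>insert i I. \<bar>c k - d k\<bar>) / b)) * (\<integral>\<^sup>+x. ?g (?s d x) \<partial>PiM I (\<lambda>_. ?L))"
    using insert.hyps by (simp add: add_divide_distrib exp_add ennreal_mult mult.assoc)
  finally show ?case
    unfolding split .
qed

section \<open>From product measures to random vectors\<close>

lemma measurable_vec_lambda_PiM:
  "(\<lambda>x. \<chi> k. x k) \<in> PiM (UNIV :: 'm::finite set) (\<lambda>_. borel) \<rightarrow>\<^sub>M (borel :: (real ^ 'm) measure)"
proof (rule borel_measurable_euclidean_space[THEN iffD2], rule ballI)
  fix u :: "real ^ 'm"
  assume "u \<in> Basis"
  then obtain i where "u = axis i 1"
    by (auto simp: Basis_vec_def)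
  then have "(\<lambda>x. (\<chi> k. x k) \<bullet> u) = (\<lambda>x. x i)"
    by (simp add: inner_axis)
  then show "(\<lambda>x. (\<chi> k. x k) \<bullet> u) \<in> borel_measurable (PiM UNIV (\<lambda>_. borel))"
    using measurable_component_singleton[of i UNIV "\<lambda>_. borel"] by simp
qed

text \<open>By independence the noise has a product law, so the two output distributions are
  translates of it by \<open>q s'\<close> and \<open>q s''\<close>. Their ratio is at most
  \<open>exp (norm1 (q s' - q s'') / b)\<close>, and the sensitivity bound makes the exponent at
  most \<open>\<rho>\<close>.\<close>

lemma laplace_mechanism_private:
  fixes q :: "real ^ 'l::finite \<Rightarrow> real ^ 'm::finite"
  assumes P: "prob_space P" and Y: "iid_laplace P b Y" and b: "b > 0"
    and sens: "\<And>s' s''. \<lbrakk>s' \<in> S; s'' \<in> S; norm0 (s' - s'') \<le> 1; norm1 (s' - s'') \<le> \<Delta>\<rbrakk>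
      \<Longrightarrow> norm1 (q s' - q s'') \<le> \<rho> * b"
  shows "differentially_private P S \<Delta> \<rho> (\<lambda>s \<omega>. \<chi> k. q s $ k + Y k \<omega>)"
proof -
  interpret prob_space P by (rule P)
  let ?N = "PiM (UNIV :: 'm set) (\<lambda>_. borel :: real measure)"
  let ?L = "PiM (UNIV :: 'm set) (\<lambda>_. laplace_measure b)"
  have Ym [measurable]: "Y k \<in> borel_measurable P" for k
    using Y by (auto simp: iid_laplace_def distributed_def)
  have dY: "distr P borel (Y k) = laplace_measure b" for k
  proof -
    \<comment> \<open>\<open>distributed\<close> is stated for the target \<open>lborel\<close>,
      independence for \<open>borel\<close>; \<open>distr\<close> depends only on the sigma-algebra
      of its target.\<close>
    have "distr P borel (Y k) = distr P lborel (Y k)"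
      by (rule distr_cong) auto
    then show ?thesis
      using Y by (auto simp: iid_laplace_def distributed_def laplace_measure_def)
  qed
  have joint: "distr P ?N (\<lambda>\<omega> k. Y k \<omega>) = ?L"
    using Y indep_vars_iff_distr_eq_PiM[where I=UNIV and M'="\<lambda>_. borel" and X=Y]
    by (simp add: iid_laplace_def dY restrict_UNIV)
  have Yvec: "(\<lambda>\<omega> k. Y k \<omega>) \<in> P \<rightarrow>\<^sub>M ?N"
    using measurable_restrict[where I=UNIV and X=Y and N=P and M="\<lambda>_. borel"] by (simp add: restrict_UNIV)
  let ?F = "\<lambda>s \<omega>. \<chi> k. q s $ k + Y k \<omega>"
  have shift: "(\<lambda>x k. q s $ k + x k) \<in> ?N \<rightarrow>\<^sub>M ?N" for s
    using measurable_restrict[where I=UNIV and X="\<lambda>k x. q s $ k + x k" and N="?N" and M="\<lambda>_. borel"]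
    by (simp add: restrict_UNIV)
  have Fm [measurable]: "?F s \<in> borel_measurable P" for s
    using measurable_compose[OF measurable_compose[OF Yvec shift] measurable_vec_lambda_PiM] by simp
  \<comment> \<open>The restriction to \<open>UNIV\<close> changes nothing; it matches the form of
    \<open>nn_integral_PiM_laplace_shift\<close>.\<close>
  have law: "emeasure P {\<omega> \<in> space P. ?F s \<omega> \<in> W}
      = (\<integral>\<^sup>+x. indicator W (\<chi> k. (\<lambda>k\<in>UNIV. q s $ k + x k) k) \<partial>?L)"
    if [measurable]: "W \<in> sets borel" for s W
  proof -
    have "emeasure P {\<omega> \<in> space P. ?F s \<omega> \<in> W} = (\<integral>\<^sup>+\<omega>. indicator W (?F s \<omega>) \<partial>P)"
    proof -
      have "{\<omega> \<in> space P. ?F s \<omega> \<in> W} \<in> events"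
        by measurable
      then have "emeasure P {\<omega> \<in> space P. ?F s \<omega> \<in> W}
          = (\<integral>\<^sup>+\<omega>. indicator {\<omega> \<in> space P. ?F s \<omega> \<in> W} \<omega> \<partial>P)"
        by (rule nn_integral_indicator[symmetric])
      also have "\<dots> = (\<integral>\<^sup>+\<omega>. indicator W (?F s \<omega>) \<partial>P)"
        by (intro nn_integral_cong) (simp add: indicator_def)
      finally show ?thesis .
    qed
    also have "\<dots> = (\<integral>\<^sup>+x. indicator W (\<chi> k. q s $ k + x k) \<partial>distr P ?N (\<lambda>\<omega> k. Y k \<omega>))"
      using measurable_compose[OF measurable_compose[OF shift measurable_vec_lambda_PiM]
          borel_measurable_indicator[OF that]]
      by (subst nn_integral_distr[OF Yvec]) simp_all
    finally show ?thesis by (simp add: joint)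
  qed
  have "measure P {\<omega> \<in> space P. ?F s' \<omega> \<in> W} \<le> exp \<rho> * measure P {\<omega> \<in> space P. ?F s'' \<omega> \<in> W}"
    if *: "s' \<in> S" "s'' \<in> S" "norm0 (s' - s'') \<le> 1" "norm1 (s' - s'') \<le> \<Delta>"
      and W [measurable]: "W \<in> sets borel" for s' s'' W
  proof -
    let ?h = "\<lambda>x. indicator W (\<chi> k. x k) :: ennreal"
    have h: "?h \<in> borel_measurable ?N"
      by (rule measurable_compose[OF measurable_vec_lambda_PiM borel_measurable_indicator[OF W]])
    have "(\<Sum>k\<in>UNIV. \<bar>q s' $ k - q s'' $ k\<bar>) / b \<le> \<rho>"
      using sens[OF *] b by (simp add: norm1_def field_simps)
    then have "emeasure P {\<omega> \<in> space P. ?F s' \<omega> \<in> W}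
        \<le> ennreal (exp \<rho>) * emeasure P {\<omega> \<in> space P. ?F s'' \<omega> \<in> W}"
      unfolding law[OF W]
      by (intro order_trans[OF nn_integral_PiM_laplace_shift[OF finite b h,
            of "\<lambda>k. q s' $ k" "\<lambda>k. q s'' $ k"] mult_right_mono] ennreal_leI) auto
    then show ?thesis
      unfolding emeasure_eq_measure by (subst (asm) ennreal_mult[symmetric]) auto
  qed
  then show ?thesis
    unfolding differentially_private_def using Fm by blast
qed

section \<open>Sensitivity of the optimal power flow\<close>

text \<open>Every branch leaves one bus and enters another, so each column of the incidence matrix
  sums to 0; the Laplacian has this matrix as its left factor.\<close>

lemma sum_laplacian_mult_eq_0:
  assumes "valid_network net"
  shows "(\<Sum>v\<in>UNIV. (laplacian net *v \<theta>) $ v) = 0"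
proof -
  have ne: "src net e \<noteq> tgt net e" for e
    using assms by (simp add: valid_network_def)
  have col: "(\<Sum>v\<in>UNIV. incidence net $ v $ e) = 0" for e
  proof -
    \<comment> \<open>Without self-loops the nested conditional is a difference of two indicators;
      at a self-loop it would be 1 instead of 0.\<close>
    have "(\<Sum>v\<in>UNIV. incidence net $ v $ e)
        = (\<Sum>v\<in>UNIV. (if v = src net e then 1 else 0) - (if v = tgt net e then 1 else 0))"
      using ne by (intro sum.cong) (auto simp: incidence_def)
    also have "\<dots> = 0"
      by (simp add: sum_subtractf)
    finally show ?thesis .
  qed
  have "(\<Sum>v\<in>UNIV. (incidence net *v z) $ v) = 0" for z
  proof -
    have "(\<Sum>v\<in>UNIV. (incidence net *v z) $ v) = (\<Sum>e\<in>UNIV. (\<Sum>v\<in>UNIV. incidence net $ v $ e) * z $ e)"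
      unfolding matrix_vector_mult_def sum_distrib_right by (simp, rule sum.swap)
    then show ?thesis by (simp add: col)
  qed
  then show ?thesis
    by (simp add: laplacian_def flip: matrix_vector_mul_assoc)
qed

lemma sum_UNIV_sum_type:
  fixes g :: "'a::finite + 'b::finite \<Rightarrow> 'c::comm_monoid_add"
  shows "(\<Sum>v\<in>UNIV. g v) = (\<Sum>i\<in>UNIV. g (Inl i)) + (\<Sum>j\<in>UNIV. g (Inr j))"
  by (subst UNIV_Plus_UNIV[symmetric], subst sum.Plus) auto

lemma feasible_balance:
  assumes "valid_network net" and "feasible net \<xi> sl sg \<theta>"
  shows "(\<Sum>i\<in>UNIV. sg $ i) = (\<Sum>j\<in>UNIV. sl $ j)"
  using sum_laplacian_mult_eq_0[OF assms(1), of \<theta>] assms(2)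
  by (simp add: feasible_def injection_def sum_UNIV_sum_type sum_negf)

text \<open>Unique solvability, part of \<open>Omega_f\<close>, makes the definite description in
  \<open>OPF\<close> denote an optimal pair, which is in particular feasible.\<close>

lemma OPF_balance:
  assumes "valid_network net" and "f \<in> Omega_f net \<xi>" and "sl \<in> Omega_s net \<xi>"
  shows "(\<Sum>i\<in>UNIV. OPF net \<xi> f sl $ i) = (\<Sum>j\<in>UNIV. sl $ j)"
proof -
  have "\<exists>!z. opf_solution net \<xi> f sl z"
    using assms by (auto simp: Omega_f_def)
  from theI'[OF this] obtain \<theta> where "feasible net \<xi> sl (OPF net \<xi> f sl) \<theta>"
    by (auto simp: opf_solution_def OPF_def case_prod_beta)
  then show ?thesis
    by (rule feasible_balance[OF assms(1)])
qed

section \<open>Response of the generation profile to a change of one load\<close>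

lemma norm1_minus_commute: "norm1 (x - y) = norm1 (y - x)"
  by (simp add: norm1_def abs_minus_commute)

lemma norm0_minus_commute: "norm0 (x - y) = norm0 (y - x)"
  unfolding norm0_def by (rule arg_cong[where f=card]) auto

text \<open>Vectors differing in a single coordinate are comparable, since the reals are linearly
  ordered. Monotonicity speaks of ordered pairs only, privacy of arbitrary neighbours; this closes
  the gap.\<close>

lemma norm0_le_1_cases:
  fixes x y :: "real ^ 'n::finite"
  assumes "norm0 (x - y) \<le> 1"
  shows "x = y \<or> norm0 (x - y) = 1 \<and> (x \<le> y \<or> y \<le> x)"
proof (cases "x = y")
  case False
  then have "{i. (x - y) $ i \<noteq> 0} \<noteq> {}"
    by (auto simp: vec_eq_iff)
  then have 1: "norm0 (x - y) = 1"
    using assms unfolding norm0_def by (simp add: card_gt_0_iff Suc_le_eq le_antisym del: vector_minus_component)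
  then obtain j where "{i. (x - y) $ i \<noteq> 0} = {j}"
    unfolding norm0_def by (metis card_1_singletonE)
  then have eq: "x $ i = y $ i" if "i \<noteq> j" for i
    using that by auto
  have "x $ j \<le> y $ j \<Longrightarrow> x $ i \<le> y $ i" "y $ j \<le> x $ j \<Longrightarrow> y $ i \<le> x $ i" for i
    using eq[of i] by (cases "i = j"; simp)+
  then have "x \<le> y \<or> y \<le> x"
    using linear[of "x $ j" "y $ j"] by (auto simp: less_eq_vec_def)
  with 1 show ?thesis by simp
qed simp

lemma OPF_sensitivity_le:
  assumes net: "valid_network net" "f \<in> Omega_f net \<xi>" "monotone_network \<Delta> \<epsilon> net \<xi> f"
    and s: "\<alpha> \<in> Omega_s net \<xi>" "\<beta> \<in> Omega_s net \<xi>"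
    and *: "norm0 (\<alpha> - \<beta>) = 1" "norm1 (\<alpha> - \<beta>) \<le> \<Delta>" "\<beta> \<le> \<alpha>"
  shows "norm1 (OPF net \<xi> f \<alpha> - OPF net \<xi> f \<beta>) \<le> \<Delta> + 2 * \<epsilon>"
proof -
  let ?d = "\<lambda>i. OPF net \<xi> f \<alpha> $ i - OPF net \<xi> f \<beta> $ i"
  \<comment> \<open>Monotonicity asks for a coordinatewise bound, which the \<open>L1\<close> bound
    implies.\<close>
  have "\<alpha> $ j - \<beta> $ j \<le> \<Delta>" for j
  proof -
    have "\<bar>(\<alpha> - \<beta>) $ j\<bar> \<le> norm1 (\<alpha> - \<beta>)"
      unfolding norm1_def by (rule member_le_sum) auto
    with *(2) show ?thesis by simp
  qed
  then have "\<alpha> \<le> \<beta> + vec \<Delta>"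
    by (auto simp: less_eq_vec_def algebra_simps)
  then have neg: "(\<Sum>i\<in>UNIV. min 0 (?d i)) \<ge> - \<epsilon>"
    using net(3) s * by (auto simp: monotone_network_def)
  have "(\<Sum>i\<in>UNIV. ?d i) = (\<Sum>j\<in>UNIV. \<alpha> $ j - \<beta> $ j)"
    using OPF_balance[OF net(1,2)] s by (simp add: sum_subtractf)
  also have "\<dots> \<le> norm1 (\<alpha> - \<beta>)"
    unfolding norm1_def by (intro sum_mono) auto
  finally have "(\<Sum>i\<in>UNIV. ?d i) \<le> \<Delta>" using *(2) by simp
  \<comment> \<open>Summand by summand this is \<open>\<bar>t\<bar> = t - 2 * min 0 t\<close>; the
    total decrease is counted twice, hence \<open>2 * \<epsilon>\<close>.\<close>
  moreover have "norm1 (OPF net \<xi> f \<alpha> - OPF net \<xi> f \<beta>) = (\<Sum>i\<in>UNIV. ?d i) - 2 * (\<Sum>i\<in>UNIV. min 0 (?d i))"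
    unfolding norm1_def sum_distrib_left sum_subtractf[symmetric] by (intro sum.cong) (auto simp: min_def)
  ultimately show ?thesis using neg by simp
qed

lemma OPF_sensitivity:
  assumes net: "valid_network net" "f \<in> Omega_f net \<xi>" "monotone_network \<Delta> \<epsilon> net \<xi> f"
    and "\<Delta> > 0" "\<epsilon> \<ge> 0"
    and s: "\<alpha> \<in> Omega_s net \<xi>" "\<beta> \<in> Omega_s net \<xi>"
    and *: "norm0 (\<alpha> - \<beta>) \<le> 1" "norm1 (\<alpha> - \<beta>) \<le> \<Delta>"
  shows "norm1 (OPF net \<xi> f \<alpha> - OPF net \<xi> f \<beta>) \<le> \<Delta> + 2 * \<epsilon>"
  using norm0_le_1_cases[OF *(1)]
proof (elim disjE conjE)
  \<comment> \<open>The claim reduces to \<open>0 \<le> \<Delta> + 2 * \<epsilon>\<close>, which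
    follows from the signs of \<open>\<Delta>\<close> and \<open>\<epsilon>\<close>.\<close>
  assume "\<alpha> = \<beta>"
  then show ?thesis using assms by (simp add: norm1_def)
next
  assume "norm0 (\<alpha> - \<beta>) = 1" "\<beta> \<le> \<alpha>"
  then show ?thesis using OPF_sensitivity_le[OF net s] *(2) by blast
next
  assume "norm0 (\<alpha> - \<beta>) = 1" "\<alpha> \<le> \<beta>"
  then show ?thesis
    using OPF_sensitivity_le[OF net s(2,1)] *(2)
    by (simp add: norm1_minus_commute[of \<beta>] norm1_minus_commute[of "OPF net \<xi> f \<beta>"]
        norm0_minus_commute[of \<beta>])
qed

section \<open>Aggregation over regions\<close>

lemma sum_abs_aggregate_le:
  fixes x :: "'a::finite \<Rightarrow> real" and A :: "'r::finite \<Rightarrow> 'a set"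
  assumes "disjoint_family A"
  shows "(\<Sum>i\<in>UNIV. \<bar>\<Sum>j\<in>A i. x j\<bar>) \<le> (\<Sum>j\<in>UNIV. \<bar>x j\<bar>)"
proof -
  have "(\<Sum>i\<in>UNIV. \<bar>\<Sum>j\<in>A i. x j\<bar>) \<le> (\<Sum>i\<in>UNIV. \<Sum>j\<in>A i. \<bar>x j\<bar>)"
    by (intro sum_mono sum_abs)
  also have "\<dots> = (\<Sum>j\<in>(\<Union>i. A i). \<bar>x j\<bar>)"
    using assms by (subst sum.UNION_disjoint) (auto simp: disjoint_family_on_def)
  also have "\<dots> \<le> (\<Sum>j\<in>UNIV. \<bar>x j\<bar>)"
    by (intro sum_mono2) auto
  finally show ?thesis .
qed

theorem theorem3:
  fixes net :: "('g::finite, 'l::finite, 'e::finite) dc_network"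
    and \<xi> :: "('g, 'e) limits"
    and f :: "real ^ 'g"
    and \<Delta> \<epsilon> \<rho> :: real
    and R :: "'r::finite \<Rightarrow> ('g + 'l) set"
    and P :: "'w measure"
    and Yg Yl :: "'r \<Rightarrow> 'w \<Rightarrow> real"
  assumes "valid_network net"
    and "\<Delta> > 0" and "\<epsilon> \<ge> 0" and "\<rho> > 0"
    and "\<xi> \<in> Omega net"
    and "f \<in> Omega_f net \<xi>"
    and "monotone_network \<Delta> \<epsilon> net \<xi> f"
    and "partition_on UNIV (range R)" and "inj R"
    and "prob_space P"
    and "iid_laplace P (2 * (\<Delta> + \<epsilon>) / \<rho>) (case_sum Yg Yl)"
  shows "differentially_private P (Omega_s net \<xi>) \<Delta> \<rho> (aggregation_mechanism net \<xi> f R Yg Yl)"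
proof -
  \<comment> \<open>The noise-free query; with it the mechanism has the additive form of
    \<open>laplace_mechanism_private\<close>.\<close>
  define q :: "real ^ 'l \<Rightarrow> real ^ ('r + 'r)" where
    "q sl = (\<chi> k. case k of Inl i \<Rightarrow> (\<Sum>j | Inl j \<in> R i. OPF net \<xi> f sl $ j)
                      | Inr i \<Rightarrow> (\<Sum>j | Inr j \<in> R i. sl $ j))" for sl
  have mech: "aggregation_mechanism net \<xi> f R Yg Yl = (\<lambda>s \<omega>. \<chi> k. q s $ k + case_sum Yg Yl k \<omega>)"
    by (auto simp: fun_eq_iff vec_eq_iff aggregation_mechanism_def q_def split: sum.split)
  \<comment> \<open>A partition separates distinct blocks; injectivity of \<open>R\<close> makes
    blocks with distinct indices distinct.\<close>
  have disj: "R i \<inter> R i' = {}" if "i \<noteq> i'" for i i'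
    using that assms(8,9) by (auto simp: partition_on_def disjoint_def inj_eq)
  have "norm1 (q s' - q s'') \<le> \<rho> * (2 * (\<Delta> + \<epsilon>) / \<rho>)"
    if s: "s' \<in> Omega_s net \<xi>" "s'' \<in> Omega_s net \<xi>" "norm0 (s' - s'') \<le> 1" "norm1 (s' - s'') \<le> \<Delta>"
    for s' s''
  proof -
    have "norm1 (q s' - q s'')
        = (\<Sum>i\<in>UNIV. \<bar>\<Sum>j | Inl j \<in> R i. OPF net \<xi> f s' $ j - OPF net \<xi> f s'' $ j\<bar>)
        + (\<Sum>i\<in>UNIV. \<bar>\<Sum>j | Inr j \<in> R i. s' $ j - s'' $ j\<bar>)"
      by (simp add: norm1_def q_def sum_UNIV_sum_type sum_subtractf)
    also have "\<dots> \<le> norm1 (OPF net \<xi> f s' - OPF net \<xi> f s'') + norm1 (s' - s'')"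
      unfolding norm1_def vector_minus_component
      using disj by (intro add_mono sum_abs_aggregate_le) (fastforce simp: disjoint_family_on_def)+
    \<comment> \<open>Generation contributes \<open>\<Delta> + 2 * \<epsilon>\<close> and load
      \<open>\<Delta>\<close>. The sum \<open>2 * (\<Delta> + \<epsilon>)\<close> is exactly
      \<open>\<rho>\<close> times the noise scale.\<close>
    also have "\<dots> \<le> (\<Delta> + 2 * \<epsilon>) + \<Delta>"
      using OPF_sensitivity[OF assms(1,6,7,2,3) s] s(4) by simp
    finally show ?thesis using assms(4) by simp
  qed
  moreover have "2 * (\<Delta> + \<epsilon>) / \<rho> > 0"
    using assms(2-4) by simp
  ultimately show ?thesis
    unfolding mech by (rule laplace_mechanism_private[OF assms(10,11), rotated])
qed

end
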